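(* Consider the statistical experiments $$\mathfrak{E}=\bigl(\mathbb{N}_0,\mathcal{P}(\mathbb{N}_0),\{\mathrm{Po}(\theta):\theta\in(0,\infty)\}\bigr)\quad\text{and}\quad \mathfrak{F}=\bigl(\mathbb{R}_{>0},\mathcal{B}_{>0},\{\chi_1^2(2\theta):\theta\in(0,\infty)\}\bigr),$$ with Fisher informations $i_{\mathfrak{E}}(\theta)$ and $i_{\mathfrak{F}}(\theta)$, and let $g_{1,\theta}$ be the continuous density of $\chi_1^2(2\theta)$ on $(0,\infty)$. Then, for all $\theta>0$, $$i_{\mathfrak{F}}(\theta)=\frac{1}{2\theta}\int_0^\infty x\,\tanh^2\bigl((2\theta x)^{1/2}\bigr)\,g_{1,\theta}(x)\,dx-1.$$ In particular, with $r(\theta):=\theta\, i_{\mathfrak{F}}(\theta)$ for all $\theta>0$, $$\lim_{\theta\to0}r(\theta)=0,\qquad \lim_{\theta\to\infty}r(\theta)=\frac12,$$ and $r$ is strictly increasing. Finally, $$i_{\mathfrak{F}}(\theta)\le\frac12\, i_{\mathfrak{E}}(\theta)\quad\text{for all }\theta>0.$$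
   Context: $\mathcal{P}(\mathbb{N}_0)$ is the power set of $\mathbb{N}_0=\{0,1,2,\dots\}$, and $\mathcal{B}_{>0}$ is the Borel $\sigma$-field on $\mathbb{R}_{>0}=(0,\infty)$. $\mathrm{Po}(\theta)$ is the Poisson distribution with parameter $\theta$. $\chi_1^2(2\theta)$ is the noncentral chi-squared distribution with one degree of freedom and noncentrality parameter $2\theta$, i.e. $\chi_1^2(2\theta)=\sum_{k=0}^\infty\mathrm{Po}(\theta)(\{k\})\,\chi_{2k+1}^2$; its continuous density on $(0,\infty)$ is $g_{1,\theta}(x)=\sum_{k=0}^\infty e^{-\theta}\frac{\theta^k}{k!}f_{2k+1}(x)$, where $f_m(x)=\frac{x^{m/2-1}e^{-x/2}}{2^{m/2}\Gamma(m/2)}$ is the density of the central chi-squared distribution $\chi_m^2$ with $m$ degrees of freedom. Fisher information: for an experiment $(S,\mathcal{S},\{P_\theta:\theta\in\Theta\})$ with $\Theta\subset\mathbb{R}$ open and $P_\theta$ having density $f(\cdot,\theta)$ with respect to a $\sigma$-finite measure, the Fisher information at $\theta$ is $\int\bigl(\frac{\partial}{\partial\theta}\log f(x,\theta)\bigr)^2P_\theta(dx)$. (For $\mathfrak{E}$ take densities with respect to counting measure, for $\mathfrak{F}$ with respect to Lebesgue measure.) *)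

theory Defs
  imports "HOL-Probability.Probability"
begin

text \<open>
  A one-parameter statistical model \<open>P\<close> over an open parameter set \<open>\<Theta>\<close>, with densities \<open>f \<theta>\<close>
  with respect to a common sigma-finite measure \<open>\<mu>\<close>; the sample space is the measurable space
  underlying \<open>\<mu>\<close>.
\<close>

definition dominated_model ::
  "real set \<Rightarrow> (real \<Rightarrow> 'a measure) \<Rightarrow> 'a measure \<Rightarrow> (real \<Rightarrow> 'a \<Rightarrow> real) \<Rightarrow> bool" where
  "dominated_model \<Theta> P \<mu> f \<longleftrightarrow>
     open \<Theta> \<and> sigma_finite_measure \<mu> \<and>
     (\<forall>\<theta>\<in>\<Theta>. prob_space (P \<theta>) \<and> f \<theta> \<in> borel_measurable \<mu> \<and> (\<forall>x\<in>space \<mu>. 0 \<le> f \<theta> x) \<and>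
        P \<theta> = density \<mu> (\<lambda>x. ennreal (f \<theta> x)))"

text \<open>
  Only the values of \<open>f\<close> at parameters near \<open>\<theta>\<close> matter. The integral is taken in \<open>[0, \<infinity>]\<close>, so
  that its finiteness is a statement and not a convention.
\<close>

definition fisher_information ::
  "(real \<Rightarrow> 'a measure) \<Rightarrow> (real \<Rightarrow> 'a \<Rightarrow> real) \<Rightarrow> real \<Rightarrow> ennreal" where
  "fisher_information P f \<theta> = (\<integral>\<^sup>+x. ennreal ((deriv (\<lambda>t. ln (f t x)) \<theta>)\<^sup>2) \<partial>P \<theta>)"

definition lborel_pos :: "real measure" where
  "lborel_pos = restrict_space lborel {0<..}"

definition chi_square_density :: "nat \<Rightarrow> real \<Rightarrow> real" where
  "chi_square_density m x =
     x powr (real m / 2 - 1) * exp (- x / 2) / (2 powr (real m / 2) * Gamma (real m / 2))"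

definition chi_square :: "nat \<Rightarrow> real measure" where
  "chi_square m = density lborel_pos (\<lambda>x. ennreal (chi_square_density m x))"

text \<open>
  One degree of freedom and noncentrality parameter \<open>l\<close>: the mixture of the measures
  \<open>chi_square (2 * k + 1)\<close> with the Poisson weights of rate \<open>l / 2\<close>.
\<close>

definition noncentral_chi_square_1 :: "real \<Rightarrow> real measure" where
  "noncentral_chi_square_1 l =
     measure_pmf (poisson_pmf (l / 2)) \<bind> (\<lambda>k. chi_square (2 * k + 1))"

text \<open>The continuous density of \<open>noncentral_chi_square_1 (2 * \<theta>)\<close>.\<close>

definition ncchi_density :: "real \<Rightarrow> real \<Rightarrow> real" where
  "ncchi_density \<theta> x = (\<Sum>k. exp (- \<theta>) * \<theta> ^ k / fact k * chi_square_density (2 * k + 1) x)"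

definition fisher_poisson :: "real \<Rightarrow> ennreal" where
  "fisher_poisson = fisher_information (\<lambda>\<theta>. measure_pmf (poisson_pmf \<theta>)) (\<lambda>\<theta>. pmf (poisson_pmf \<theta>))"

definition fisher_ncchi :: "real \<Rightarrow> ennreal" where
  "fisher_ncchi = fisher_information (\<lambda>\<theta>. noncentral_chi_square_1 (2 * \<theta>)) ncchi_density"


lemma dominated_model_poisson:
  "dominated_model {0<..} (\<lambda>\<theta>. measure_pmf (poisson_pmf \<theta>)) (count_space UNIV) (\<lambda>\<theta>. pmf (poisson_pmf \<theta>))"
  unfolding dominated_model_def
  by (intro conjI ballI measure_pmf_eq_density sigma_finite_measure_count_space
      measure_pmf.prob_space_axioms pmf_nonneg) auto

lemma space_lborel_pos: "space lborel_pos = {0<..}"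
  by (simp add: lborel_pos_def space_restrict_space)

lemma sets_lborel_pos: "sets lborel_pos = sets (restrict_space borel {0<..})"
  by (simp add: lborel_pos_def sets_restrict_space)

lemma nn_integral_lborel_pos:
  "(\<integral>\<^sup>+x. h x \<partial>lborel_pos) = (\<integral>\<^sup>+x\<in>{0<..}. h x \<partial>lborel)"
  unfolding lborel_pos_def by (subst nn_integral_restrict_space) auto

lemma borel_measurable_lborel_pos:
  "h \<in> borel_measurable borel \<Longrightarrow> h \<in> borel_measurable lborel_pos"
  unfolding lborel_pos_def by (rule measurable_restrict_space1) simp

lemma chi_square_density_borel [measurable]: "chi_square_density m \<in> borel_measurable borel"
  unfolding chi_square_density_def by measurable

lemma chi_square_density_nonneg: "chi_square_density m x \<ge> 0"
proof (cases "m = 0")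
  case True
  then show ?thesis by (simp add: chi_square_density_def)
next
  case False
  then have "Gamma (real m / 2) > 0" by (intro Gamma_real_pos) auto
  then show ?thesis by (simp add: chi_square_density_def)
qed

lemma nn_integral_chi_square_density:
  assumes "m > 0"
  shows "(\<integral>\<^sup>+x\<in>{0<..}. ennreal (chi_square_density m x) \<partial>lborel) = 1"
proof -
  define a where "a = real m / 2"
  have a: "a > 0" using assms by (simp add: a_def)
  have G: "Gamma a > 0" using a by (rule Gamma_real_pos)
  define h where "h t = indicator {0..} t * (t powr (a - 1) / exp t)" for t :: real
  have [measurable]: "h \<in> borel_measurable borel" unfolding h_def by measurable
  have "(h has_integral Gamma a) UNIV"
  proof -
    have "((\<lambda>t. if t \<in> {0..} then t powr (a - 1) / exp t else 0) has_integral Gamma a) UNIV"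
      using Gamma_integral_real[OF a] by (simp only: has_integral_restrict_UNIV)
    moreover have "(\<lambda>t. if t \<in> {0..} then t powr (a - 1) / exp t else 0) = h"
      by (auto simp: h_def fun_eq_iff)
    ultimately show ?thesis by simp
  qed
  then have I: "(\<integral>\<^sup>+t. ennreal (h t) \<partial>lborel) = ennreal (Gamma a)"
    by (rule nn_integral_has_integral_lborel[rotated 2]) (auto simp: h_def)
  have "(\<integral>\<^sup>+t. ennreal (h t) \<partial>lborel) = ennreal (1/2) * (\<integral>\<^sup>+t. ennreal (h (0 + (1/2) * t)) \<partial>lborel)"
    using nn_integral_real_affine[of "\<lambda>t. ennreal (h t)" "1/2" 0] by simp
  also have "\<dots> = (\<integral>\<^sup>+t. ennreal (1/2) * ennreal (h (t/2)) \<partial>lborel)"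
    by (subst nn_integral_cmult) auto
  also have "\<dots> = (\<integral>\<^sup>+t. ennreal (Gamma a) * (ennreal (chi_square_density m t) * indicator {0<..} t) \<partial>lborel)"
  proof (rule nn_integral_cong_AE)
    have "AE t in lborel. t \<noteq> (0::real)" by (rule AE_lborel_singleton)
    then show "AE t in lborel. ennreal (1/2) * ennreal (h (t/2)) =
        ennreal (Gamma a) * (ennreal (chi_square_density m t) * indicator {0<..} t)"
    proof eventually_elim
      case (elim t)
      show ?case
      proof (cases "t > 0")
        case True
        have "(1/2) * h (t/2) = Gamma a * chi_square_density m t"
          using True G
          by (simp add: h_def chi_square_density_def a_def[symmetric] powr_divide powr_diff
              exp_minus field_simps)
        then have "ennreal (1/2) * ennreal (h (t/2)) = ennreal (Gamma a) * ennreal (chi_square_density m t)"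
          using G by (metis ennreal_mult' half_gt_zero less_imp_le zero_less_one)
        then show ?thesis using True by simp
      next
        case False
        then show ?thesis using elim by (simp add: h_def)
      qed
    qed
  qed
  also have "\<dots> = ennreal (Gamma a) * (\<integral>\<^sup>+x\<in>{0<..}. ennreal (chi_square_density m x) \<partial>lborel)"
    by (subst nn_integral_cmult) auto
  finally have "ennreal (Gamma a) * (\<integral>\<^sup>+x\<in>{0<..}. ennreal (chi_square_density m x) \<partial>lborel)
      = ennreal (Gamma a) * 1" using I by simp
  then show ?thesis
    using G by (subst (asm) ennreal_mult_cancel_left) auto
qed

lemma prob_space_chi_square:
  assumes "m > 0"
  shows "prob_space (chi_square m)"
proof
  have "emeasure (chi_square m) (space (chi_square m)) = (\<integral>\<^sup>+x. ennreal (chi_square_density m x) \<partial>lborel_pos)"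
    unfolding chi_square_def
    by (subst emeasure_density)
      (auto intro!: nn_integral_cong borel_measurable_lborel_pos)
  then show "emeasure (chi_square m) (space (chi_square m)) = 1"
    using assms by (simp add: nn_integral_lborel_pos nn_integral_chi_square_density)
qed

lemma chi_square_kernel:
  "(\<lambda>k. chi_square (2 * k + 1)) \<in> measure_pmf p \<rightarrow>\<^sub>M subprob_algebra lborel_pos"
  by (auto simp: space_subprob_algebra chi_square_def
      intro!: prob_space_imp_subprob_space prob_space_chi_square[unfolded chi_square_def])

lemma gamma_odd_half_ge:
  "Gamma (real (2 * k + 1) / 2) \<ge> sqrt pi / 2 ^ k"
proof (induction k)
  case 0
  then show ?case by (simp add: Gamma_one_half_real)
next
  case (Suc k)
  have eq: "real (2 * Suc k + 1) / 2 = real (2 * k + 1) / 2 + 1" by (simp add: field_simps)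
  have pos: "real (2 * k + 1) / 2 > 0" by simp
  have "sqrt pi / 2 ^ Suc k = (1/2) * (sqrt pi / 2 ^ k)" by simp
  also have "\<dots> \<le> (real (2 * k + 1) / 2) * Gamma (real (2 * k + 1) / 2)"
    using Suc by (intro mult_mono) auto
  also have "\<dots> = Gamma (real (2 * Suc k + 1) / 2)"
    unfolding eq using pos by (subst Gamma_plus1) (auto elim!: nonpos_Ints_cases)
  finally show ?case .
qed

definition ncchi_coeff :: "real \<Rightarrow> nat \<Rightarrow> real" where
  "ncchi_coeff \<theta> k = \<theta> ^ k / (fact k * 2 ^ k * Gamma (real (2 * k + 1) / 2))"

lemma summable_ncchi_coeff: "summable (\<lambda>k. ncchi_coeff \<theta> k * x ^ k)"
proof (rule summable_comparison_test')
  show "summable (\<lambda>k. (1 / sqrt pi) * (\<bar>\<theta> * x\<bar> ^ k / fact k))"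
    using summable_exp[of "\<bar>\<theta> * x\<bar>"] by (intro summable_mult) (simp add: field_simps)
  fix k :: nat
  have g: "Gamma (real (2 * k + 1) / 2) \<ge> sqrt pi / 2 ^ k" by (rule gamma_odd_half_ge)
  have p: "sqrt pi / 2 ^ k > 0" by simp
  have g': "2 ^ k * Gamma (real (2 * k + 1) / 2) \<ge> sqrt pi"
    using g by (simp add: field_simps)
  have "norm (ncchi_coeff \<theta> k * x ^ k) = (\<bar>\<theta> * x\<bar> ^ k / fact k) * (1 / (2 ^ k * Gamma (real (2 * k + 1) / 2)))"
    using g p by (simp add: ncchi_coeff_def abs_mult power_abs power_mult_distrib)
  also have "\<dots> \<le> (\<bar>\<theta> * x\<bar> ^ k / fact k) * (1 / sqrt pi)"
    using g' by (intro mult_left_mono divide_left_mono) (auto intro!: mult_pos_pos less_le_trans[OF _ g'])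
  finally show "norm (ncchi_coeff \<theta> k * x ^ k) \<le> (1 / sqrt pi) * (\<bar>\<theta> * x\<bar> ^ k / fact k)"
    by (simp add: mult.commute)
qed

lemma ncchi_term:
  assumes "x > 0"
  shows "exp (- \<theta>) * \<theta> ^ k / fact k * chi_square_density (2 * k + 1) x =
    exp (- \<theta> - x / 2) / sqrt (2 * x) * (ncchi_coeff \<theta> k * x ^ k)"
proof -
  have e: "real (2 * k + 1) / 2 = real k + 1 / 2" by (simp add: field_simps)
  have e': "real (2 * k + 1) / 2 - 1 = real k - 1 / 2" by (simp add: field_simps)
  have "x powr (real k - 1 / 2) = x ^ k / sqrt x"
    using assms by (simp add: powr_diff powr_realpow powr_half_sqrt)
  moreover have "2 powr (real k + 1 / 2) = 2 ^ k * sqrt 2"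
    by (simp add: powr_add powr_realpow powr_half_sqrt)
  ultimately have d: "chi_square_density (2 * k + 1) x =
      x ^ k / sqrt x * exp (- x / 2) / (2 ^ k * sqrt 2 * Gamma (real k + 1 / 2))"
    unfolding chi_square_density_def e' by (simp only: e)
  have "exp (- \<theta> - x / 2) = exp (- \<theta>) * exp (- x / 2)"
    by (simp flip: exp_add)
  then show ?thesis
    unfolding d ncchi_coeff_def e by (simp only: real_sqrt_mult times_divide_times_eq
      times_divide_eq_left times_divide_eq_right divide_divide_eq_left mult_ac)
qed

lemma summable_ncchi_density:
  assumes "x > 0"
  shows "summable (\<lambda>k. exp (- \<theta>) * \<theta> ^ k / fact k * chi_square_density (2 * k + 1) x)"
  unfolding ncchi_term[OF assms] by (intro summable_mult summable_ncchi_coeff)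

lemma ncchi_density_powser:
  assumes "x > 0"
  shows "ncchi_density \<theta> x = exp (- \<theta> - x / 2) / sqrt (2 * x) * (\<Sum>k. ncchi_coeff \<theta> k * x ^ k)"
  unfolding ncchi_density_def ncchi_term[OF assms] by (intro suminf_mult summable_ncchi_coeff)

lemma continuous_on_ncchi_density: "continuous_on {0<..} (ncchi_density \<theta>)"
proof -
  have "isCont (\<lambda>x. \<Sum>k. ncchi_coeff \<theta> k * x ^ k) x" for x
    by (rule isCont_powser[where K = "\<bar>x\<bar> + 1"]) (auto intro: summable_ncchi_coeff)
  then have "continuous_on {0<..} (\<lambda>x. \<Sum>k. ncchi_coeff \<theta> k * x ^ k)"
    by (intro continuous_at_imp_continuous_on) auto
  then have "continuous_on {0<..}
      (\<lambda>x. exp (- \<theta> - x / 2) / sqrt (2 * x) * (\<Sum>k. ncchi_coeff \<theta> k * x ^ k))"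
    by (intro continuous_intros) auto
  then show ?thesis
    by (rule continuous_on_eq) (simp add: ncchi_density_powser)
qed

lemma ncchi_density_borel [measurable]: "ncchi_density \<theta> \<in> borel_measurable borel"
  unfolding ncchi_density_def by measurable

lemma ncchi_density_nonneg:
  assumes "\<theta> \<ge> 0" "x > 0"
  shows "ncchi_density \<theta> x \<ge> 0"
  unfolding ncchi_density_def
  using assms by (intro suminf_nonneg summable_ncchi_density) (auto simp: chi_square_density_nonneg)

lemma noncentral_chi_square_1_density:
  assumes "\<theta> > 0"
  shows "noncentral_chi_square_1 (2 * \<theta>) = density lborel_pos (\<lambda>x. ennreal (ncchi_density \<theta> x))"
proof (rule measure_eqI)
  show s: "sets (noncentral_chi_square_1 (2 * \<theta>)) = sets (density lborel_pos (\<lambda>x. ennreal (ncchi_density \<theta> x)))"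
    unfolding noncentral_chi_square_1_def by (simp add: chi_square_def)
  fix A assume "A \<in> sets (noncentral_chi_square_1 (2 * \<theta>))"
  then have A [measurable]: "A \<in> sets lborel_pos" using s by simp
  note [measurable] = borel_measurable_lborel_pos
  let ?t = "\<lambda>k x. exp (- \<theta>) * \<theta> ^ k / fact k * chi_square_density (2 * k + 1) x"
  have t0: "?t k x \<ge> 0" for k x
    using assms by (simp add: chi_square_density_nonneg)
  have "emeasure (noncentral_chi_square_1 (2 * \<theta>)) A =
      (\<integral>\<^sup>+k. emeasure (chi_square (2 * k + 1)) A \<partial>measure_pmf (poisson_pmf \<theta>))"
    unfolding noncentral_chi_square_1_def
    using emeasure_bind[OF _ chi_square_kernel A] by simp
  also have "\<dots> = (\<Sum>k. ennreal (pmf (poisson_pmf \<theta>) k) * emeasure (chi_square (2 * k + 1)) A)"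
    by (simp add: nn_integral_measure_pmf nn_integral_count_space_nat)
  also have "\<dots> = (\<Sum>k. \<integral>\<^sup>+x. ennreal (?t k x) * indicator A x \<partial>lborel_pos)"
  proof (rule suminf_cong)
    fix k
    have w: "ennreal (pmf (poisson_pmf \<theta>) k) * ennreal (chi_square_density (2 * k + 1) x) = ennreal (?t k x)" for x
    proof -
      have "pmf (poisson_pmf \<theta>) k * chi_square_density (2 * k + 1) x = ?t k x"
        using assms by simp
      then show ?thesis by (metis ennreal_mult' pmf_nonneg)
    qed
    have "ennreal (pmf (poisson_pmf \<theta>) k) * emeasure (chi_square (2 * k + 1)) A =
        (\<integral>\<^sup>+x. ennreal (pmf (poisson_pmf \<theta>) k) * (ennreal (chi_square_density (2 * k + 1) x) * indicator A x) \<partial>lborel_pos)"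
      unfolding chi_square_def
      by (subst emeasure_density) (auto simp: nn_integral_cmult)
    also have "\<dots> = (\<integral>\<^sup>+x. ennreal (?t k x) * indicator A x \<partial>lborel_pos)"
      by (simp only: mult.assoc[symmetric] w)
    finally show "ennreal (pmf (poisson_pmf \<theta>) k) * emeasure (chi_square (2 * k + 1)) A =
        (\<integral>\<^sup>+x. ennreal (?t k x) * indicator A x \<partial>lborel_pos)" .
  qed
  also have "\<dots> = (\<integral>\<^sup>+x. (\<Sum>k. ennreal (?t k x) * indicator A x) \<partial>lborel_pos)"
    by (subst nn_integral_suminf) auto
  also have "\<dots> = (\<integral>\<^sup>+x. ennreal (ncchi_density \<theta> x) * indicator A x \<partial>lborel_pos)"
  proof (rule nn_integral_cong)
    fix x assume "x \<in> space lborel_pos"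
    then have x: "x > 0" by (simp add: space_lborel_pos)
    have "(\<Sum>k. ennreal (?t k x)) = ennreal (ncchi_density \<theta> x)"
      unfolding ncchi_density_def
      by (rule suminf_ennreal2[OF t0 summable_ncchi_density[OF x]])
    then show "(\<Sum>k. ennreal (?t k x) * indicator A x) = ennreal (ncchi_density \<theta> x) * indicator A x"
      by simp
  qed
  also have "\<dots> = emeasure (density lborel_pos (\<lambda>x. ennreal (ncchi_density \<theta> x))) A"
    by (subst emeasure_density) auto
  finally show "emeasure (noncentral_chi_square_1 (2 * \<theta>)) A =
      emeasure (density lborel_pos (\<lambda>x. ennreal (ncchi_density \<theta> x))) A" .
qed

lemma dominated_model_ncchi:
  "dominated_model {0<..} (\<lambda>\<theta>. noncentral_chi_square_1 (2 * \<theta>)) lborel_pos ncchi_density"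
proof -
  have "sigma_finite_measure lborel_pos"
    unfolding lborel_pos_def
    by (intro sigma_finite_measure_restrict_space lborel.sigma_finite_measure_axioms) auto
  moreover have "prob_space (noncentral_chi_square_1 (2 * \<theta>))" for \<theta>
    unfolding noncentral_chi_square_1_def
    by (rule measure_pmf.prob_space_bind[OF _ chi_square_kernel])
      (simp add: prob_space_chi_square)
  ultimately show ?thesis
    unfolding dominated_model_def
    by (intro conjI ballI)
      (auto simp: space_lborel_pos ncchi_density_nonneg borel_measurable_lborel_pos
        intro: noncentral_chi_square_1_density)
qed

end

theory Submission
  imports Defs
begin

text \<open>
  Write \<open>f\<^sub>m\<close> for the central chi-squared density, \<open>g\<close> for the density at parameter \<open>\<theta>\<close> and
  \<open>y = sqrt (2 * \<theta> * x)\<close>. The mixture defining \<open>g\<close> is the power series of a hyperbolic cosine,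
  \<open>g x = exp (- \<theta>) * f\<^sub>1 x * cosh y\<close>, so the score is \<open>x * tanh y / y - 1\<close>. Because of
  \<open>x * f\<^sub>m x = m * f\<^sub>m\<^sub>+\<^sub>2 x\<close>, each of \<open>g x\<close>, \<open>(x * tanh y / y) * g x\<close> and \<open>x * g x\<close> is a series of
  chi-squared densities, so its integral is the sum of its weights. These are the Poisson
  probabilities \<open>p\<^sub>k\<close> in the first two cases and \<open>(2 * k + 1) * p\<^sub>k\<close> in the third, with sums \<open>1\<close>, \<open>1\<close> and
  \<open>1 + 2 * \<theta>\<close>. Expanding the square of the score gives the formula for the information.

  The remaining claims become visible after replacing \<open>tanh\<^sup>2\<close> by \<open>1 - 1 / cosh\<^sup>2\<close>: one factor
  \<open>cosh y\<close> cancels against \<open>g\<close>, and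
  \<open>\<theta> * i(\<theta>) = (1 - exp (- \<theta>) * K \<theta>) / 2\<close> with \<open>K \<theta> = \<integral> f\<^sub>3 x / cosh y dx\<close>.
  Both \<open>exp (- \<theta>)\<close> and \<open>K \<theta>\<close> are positive and decreasing in \<open>\<theta>\<close>, \<open>K\<close> is at most \<open>1\<close>, and \<open>K \<theta>\<close> tends to
  \<open>\<integral> f\<^sub>3 = 1\<close> at \<open>0\<close> by dominated convergence. This gives the two limits, the strict monotonicity,
  and the bound \<open>\<theta> * i(\<theta>) \<le> 1 / 2\<close>, where \<open>1 / \<theta>\<close> is the Fisher information of the Poisson
  experiment.
\<close>

section \<open>Power series of the hyperbolic functions\<close>

lemma cosh_even_sums:
  fixes y :: real
  shows "(\<lambda>k. y ^ (2 * k) / fact (2 * k)) sums cosh y"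
proof -
  have "(\<lambda>k. (\<lambda>n. if even n then y ^ n /\<^sub>R fact n else 0) (2 * k)) sums cosh y"
    by (subst sums_mono_reindex) (auto simp: strict_mono_def elim!: evenE intro: cosh_converges)
  then show ?thesis by (simp add: divide_inverse mult.commute)
qed

lemma sinh_odd_sums:
  fixes y :: real
  shows "(\<lambda>k. y ^ (2 * k + 1) / fact (2 * k + 1)) sums sinh y"
proof -
  have "(\<lambda>k. (\<lambda>n. if even n then 0 else y ^ n /\<^sub>R fact n) (2 * k + 1)) sums sinh y"
    by (subst sums_mono_reindex) (auto simp: strict_mono_def elim!: oddE intro: sinh_converges)
  then show ?thesis by (simp add: divide_inverse mult.commute)
qed

section \<open>Moments of the Poisson distribution\<close>

text \<open>The first two factorial moments; each factor \<open>k\<close> or \<open>k - 1\<close> cancels against the factorial and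
  shifts the series by one.\<close>

lemma poisson_weight_sums:
  fixes t :: real
  shows "(\<lambda>k. exp (- t) * t ^ k / fact k) sums 1"
    and "(\<lambda>k. real k * (exp (- t) * t ^ k / fact k)) sums t"
    and "(\<lambda>k. real k * (real k - 1) * (exp (- t) * t ^ k / fact k)) sums t\<^sup>2"
proof -
  define w where "w k = exp (- t) * t ^ k / fact k" for k
  have shift: "real (Suc k) * w (Suc k) = t * w k" for k
  proof -
    have "n * (e * (t * p) / (n * F)) = t * (e * p / F)" if "n \<noteq> 0" for n e p F :: real
      using that by simp
    from this[of "real (Suc k)" "exp (- t)" "t ^ k" "fact k"] show ?thesis
      unfolding w_def fact_Suc power_Suc by simp
  qed
  have "(\<lambda>k. exp (- t) * (t ^ k /\<^sub>R fact k)) sums (exp (- t) * exp t)"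
    by (intro sums_mult exp_converges)
  moreover have "exp (- t) * (t ^ k /\<^sub>R fact k) = w k" for k
    by (simp add: w_def divide_inverse)
  moreover have "exp (- t) * exp t = 1" by (simp flip: exp_add)
  ultimately have w0: "w sums 1" by (simp only:)
  have "(\<lambda>k. real (Suc k) * w (Suc k)) sums t"
    unfolding shift using sums_mult[OF w0, of t] by simp
  then have w1: "(\<lambda>k. real k * w k) sums t"
    using sums_Suc_iff[of "\<lambda>k. real k * w k" t] by simp
  have "real (Suc k) * (real (Suc k) - 1) * w (Suc k) = t * (real k * w k)" for k
    using arg_cong[OF shift[of k], of "\<lambda>u. real k * u"] by (simp add: mult_ac)
  then have "(\<lambda>k. real (Suc k) * (real (Suc k) - 1) * w (Suc k)) sums t\<^sup>2"
    using sums_mult[OF w1, of t] by (simp only: power2_eq_square)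
  then have w2: "(\<lambda>k. real k * (real k - 1) * w k) sums t\<^sup>2"
    using sums_Suc_iff[of "\<lambda>k. real k * (real k - 1) * w k" "t\<^sup>2"] by simp
  show "(\<lambda>k. exp (- t) * t ^ k / fact k) sums 1"
    and "(\<lambda>k. real k * (exp (- t) * t ^ k / fact k)) sums t"
    and "(\<lambda>k. real k * (real k - 1) * (exp (- t) * t ^ k / fact k)) sums t\<^sup>2"
    using w0 w1 w2 unfolding w_def .
qed

lemma fisher_poisson_eq:
  assumes "\<theta> > 0"
  shows "fisher_poisson \<theta> = ennreal (1 / \<theta>)"
proof -
  have score: "deriv (\<lambda>t. ln (pmf (poisson_pmf t) k)) \<theta> = real k / \<theta> - 1" for k
  proof (rule DERIV_imp_deriv)
    have "((\<lambda>t. real k * ln t - t - ln (fact k)) has_real_derivative real k / \<theta> - 1) (at \<theta>)"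
      using assms by (auto intro!: derivative_eq_intros simp: field_simps)
    moreover have "\<forall>\<^sub>F t in nhds \<theta>. ln (pmf (poisson_pmf t) k) = real k * ln t - t - ln (fact k)"
      using eventually_nhds_in_open[of "{0<..}" \<theta>] assms
      by (auto elim!: eventually_mono simp: ln_mult ln_div ln_realpow)
    ultimately show "((\<lambda>t. ln (pmf (poisson_pmf t) k)) has_real_derivative real k / \<theta> - 1) (at \<theta>)"
      by (subst DERIV_cong_ev[OF refl _ refl])
  qed
  let ?w = "\<lambda>k. exp (- \<theta>) * \<theta> ^ k / fact k"
  \<comment> \<open>the squared score, expanded in the factorial powers of \<open>k\<close>\<close>
  have "(\<lambda>k. (1 / \<theta>\<^sup>2) * (real k * (real k - 1) * ?w k) + (1 / \<theta>\<^sup>2 - 2 / \<theta>) * (real k * ?w k) + ?w k)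
      sums ((1 / \<theta>\<^sup>2) * \<theta>\<^sup>2 + (1 / \<theta>\<^sup>2 - 2 / \<theta>) * \<theta> + 1)"
    by (intro sums_add sums_mult poisson_weight_sums)
  moreover have "(1 / \<theta>\<^sup>2) * (real k * (real k - 1) * w) + (1 / \<theta>\<^sup>2 - 2 / \<theta>) * (real k * w) + w =
      w * (real k / \<theta> - 1)\<^sup>2" for k w
    using assms by (simp add: field_simps power2_eq_square)
  moreover have "(1 / \<theta>\<^sup>2) * \<theta>\<^sup>2 + (1 / \<theta>\<^sup>2 - 2 / \<theta>) * \<theta> + 1 = 1 / \<theta>"
    using assms by (simp add: field_simps power2_eq_square)
  ultimately have S: "(\<lambda>k. ?w k * (real k / \<theta> - 1)\<^sup>2) sums (1 / \<theta>)"
    by (simp only:)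
  have "fisher_poisson \<theta> = (\<Sum>k. ennreal (pmf (poisson_pmf \<theta>) k) * ennreal ((real k / \<theta> - 1)\<^sup>2))"
    unfolding fisher_poisson_def fisher_information_def score
    by (simp add: nn_integral_measure_pmf nn_integral_count_space_nat)
  also have "\<dots> = (\<Sum>k. ennreal (?w k * (real k / \<theta> - 1)\<^sup>2))"
  proof -
    have "pmf (poisson_pmf \<theta>) k = ?w k" for k
      using assms by simp
    then show ?thesis by (simp only: ennreal_mult'' zero_le_power2)
  qed
  also have "\<dots> = ennreal (1 / \<theta>)"
    using assms S by (subst suminf_ennreal2) (auto simp: sums_iff)
  finally show ?thesis .
qed

section \<open>Series of chi-squared densities\<close>

lemma chi_square_density_pos:
  assumes "m > 0" "x > 0"
  shows "chi_square_density m x > 0"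
  using assms by (simp add: chi_square_density_def Gamma_real_pos)

lemma chi_square_density_add_2:
  assumes "m > 0" "x > 0"
  shows "x * chi_square_density m x = real m * chi_square_density (m + 2) x"
proof -
  define a where "a = real m / 2"
  have a: "a > 0" "real m = 2 * a" using assms by (auto simp: a_def)
  have e: "real (m + 2) / 2 = a + 1" by (simp add: a_def field_simps)
  have "Gamma (a + 1) = a * Gamma a"
    using a by (intro Gamma_plus1) (auto elim!: nonpos_Ints_cases)
  moreover have "x powr a = x * x powr (a - 1)" "2 powr (a + 1) = 2 * 2 powr a"
    using assms by (simp_all add: powr_diff powr_add)
  moreover have "Gamma a > 0" using a by (intro Gamma_real_pos) auto
  ultimately show ?thesis
    unfolding chi_square_density_def e a_def[symmetric] using a by simp
qed

text \<open>Iterating the recursion from one degree of freedom produces the factor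
  \<open>x ^ k / (1 * 3 * \<dots> * (2 * k - 1))\<close>. Written with \<open>fact (2 * k)\<close> in the denominator it shows
  how the coefficients of \<open>cosh\<close> arise.\<close>

lemma chi_square_density_odd:
  assumes "x > 0"
  shows "chi_square_density (2 * k + 1) x = chi_square_density 1 x * ((2 * x) ^ k * fact k / fact (2 * k))"
proof (induction k)
  case 0
  show ?case by simp
next
  case (Suc k)
  have "chi_square_density (2 * Suc k + 1) x = x / real (2 * k + 1) * chi_square_density (2 * k + 1) x"
    using chi_square_density_add_2[of "2 * k + 1" x] assms by (simp add: field_simps)
  also have "\<dots> = chi_square_density 1 x * ((2 * x) ^ Suc k * fact (Suc k) / fact (2 * Suc k))"
  proof -
    have cancel: "x / a * (f * (p * q / F)) = f * (2 * x * p * (b * q) / (2 * b * (a * F)))"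
      if "a \<noteq> 0" "b \<noteq> 0" "F \<noteq> 0" for a b f p q F :: real
      using that by simp
    have fact_double: "fact (2 * Suc k) = 2 * real (Suc k) * (real (2 * k + 1) * fact (2 * k))"
      by (simp add: algebra_simps)
    show ?thesis
      unfolding Suc.IH power_Suc fact_Suc[of k] fact_double by (rule cancel) simp_all
  qed
  finally show ?case .
qed

lemma borel_measurable_lborel_pos_continuous:
  fixes h :: "real \<Rightarrow> real"
  assumes "continuous_on {0<..} h"
  shows "h \<in> borel_measurable lborel_pos"
  using borel_measurable_continuous_on_restrict[OF assms]
  by (simp add: measurable_cong_sets[OF sets_lborel_pos])

text \<open>All terms are nonnegative, so integral and sum may be exchanged, and every density has total
  mass \<open>1\<close>. A moment of the noncentral distribution is computed below by finding the weights with
  which its integrand is such a series and adding them up.\<close>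

lemma has_bochner_integral_chi_square_series:
  assumes w: "\<And>k. 0 \<le> w k" "w sums W"
    and m: "\<And>k. m k > 0"
    and F: "\<And>x. x > 0 \<Longrightarrow> (\<lambda>k. w k * chi_square_density (m k) x) sums F x"
    and [measurable]: "F \<in> borel_measurable lborel_pos"
  shows "has_bochner_integral lborel_pos F W"
proof (rule has_bochner_integral_nn_integral)
  note [measurable] = borel_measurable_lborel_pos
  have nn: "0 \<le> w k * chi_square_density (m k) x" for k x
    using w by (simp add: chi_square_density_nonneg)
  show "F \<in> borel_measurable lborel_pos" by simp
  show "0 \<le> W" using w suminf_nonneg[of w] by (auto simp: sums_iff)
  show "AE x in lborel_pos. 0 \<le> F x"
  proof (intro AE_I2)
    fix x assume "x \<in> space lborel_pos"
    then have S: "(\<lambda>k. w k * chi_square_density (m k) x) sums F x"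
      using F by (simp add: space_lborel_pos)
    show "0 \<le> F x"
      by (rule sums_le[OF nn sums_zero S])
  qed
  have "(\<integral>\<^sup>+x. ennreal (F x) \<partial>lborel_pos) =
      (\<integral>\<^sup>+x. (\<Sum>k. ennreal (w k * chi_square_density (m k) x)) \<partial>lborel_pos)"
    using F nn by (intro nn_integral_cong) (simp add: space_lborel_pos sums_iff suminf_ennreal2)
  also have "\<dots> = (\<Sum>k. \<integral>\<^sup>+x. ennreal (w k) * ennreal (chi_square_density (m k) x) \<partial>lborel_pos)"
    using w by (subst nn_integral_suminf) (auto simp: ennreal_mult')
  also have "\<dots> = (\<Sum>k. ennreal (w k))"
  proof (rule suminf_cong)
    fix k
    have "(\<integral>\<^sup>+x. ennreal (w k) * ennreal (chi_square_density (m k) x) \<partial>lborel_pos) =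
        ennreal (w k) * (\<integral>\<^sup>+x. ennreal (chi_square_density (m k) x) \<partial>lborel_pos)"
      by (rule nn_integral_cmult) simp
    then show "(\<integral>\<^sup>+x. ennreal (w k) * ennreal (chi_square_density (m k) x) \<partial>lborel_pos) = ennreal (w k)"
      using m by (simp add: nn_integral_lborel_pos nn_integral_chi_square_density)
  qed
  also have "\<dots> = ennreal W"
    using w by (simp add: suminf_ennreal2 sums_iff)
  finally show "(\<integral>\<^sup>+x. ennreal (F x) \<partial>lborel_pos) = ennreal W" .
qed

section \<open>The noncentral density and its moments\<close>

lemma ncchi_density_cosh:
  assumes "\<theta> \<ge> 0" "x > 0"
  shows "ncchi_density \<theta> x = exp (- \<theta>) * chi_square_density 1 x * cosh (sqrt (2 * \<theta> * x))"
proof -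
  have "(\<lambda>k. exp (- \<theta>) * chi_square_density 1 x * (sqrt (2 * \<theta> * x) ^ (2 * k) / fact (2 * k)))
      sums (exp (- \<theta>) * chi_square_density 1 x * cosh (sqrt (2 * \<theta> * x)))"
    by (intro sums_mult cosh_even_sums)
  moreover have "exp (- \<theta>) * chi_square_density 1 x * (sqrt (2 * \<theta> * x) ^ (2 * k) / fact (2 * k)) =
      exp (- \<theta>) * \<theta> ^ k / fact k * chi_square_density (2 * k + 1) x" for k
    unfolding chi_square_density_odd[OF assms(2)] using assms
    by (simp add: power_mult power_mult_distrib)
  ultimately show ?thesis
    unfolding ncchi_density_def by (simp add: sums_iff)
qed

lemma continuous_on_chi_square_density:
  assumes "m > 0"
  shows "continuous_on {0<..} (chi_square_density m)"
proof -
  have "Gamma (real m / 2) > 0" using assms by (intro Gamma_real_pos) auto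
  then show ?thesis
    unfolding chi_square_density_def by (intro continuous_intros) auto
qed

lemma has_bochner_integral_ncchi_density:
  assumes "\<theta> > 0"
  shows "has_bochner_integral lborel_pos (ncchi_density \<theta>) 1"
proof (rule has_bochner_integral_chi_square_series[OF _ poisson_weight_sums(1)[of \<theta>],
    where m = "\<lambda>k. 2 * k + 1"])
  fix x :: real assume "x > 0"
  then show "(\<lambda>k. exp (- \<theta>) * \<theta> ^ k / fact k * chi_square_density (2 * k + 1) x) sums ncchi_density \<theta> x"
    unfolding ncchi_density_def by (intro summable_sums summable_ncchi_density)
qed (use assms in \<open>auto simp: borel_measurable_lborel_pos\<close>)

text \<open>The integrand is the product of \<open>ncchi_density \<theta>\<close> and \<open>x * tanh y / y\<close>, the nonconstant part of
  the score. It is a density again, of the noncentral distribution with three degrees of freedom, so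
  this says that the score has mean zero.\<close>

lemma has_bochner_integral_sinh_term:
  assumes "\<theta> > 0"
  shows "has_bochner_integral lborel_pos
    (\<lambda>x. exp (- \<theta>) * chi_square_density 1 x * (x * sinh (sqrt (2 * \<theta> * x)) / sqrt (2 * \<theta> * x))) 1"
    (is "has_bochner_integral _ ?F _")
proof (rule has_bochner_integral_chi_square_series[OF _ poisson_weight_sums(1)[of \<theta>],
    where m = "\<lambda>k. 2 * k + 3"])
  show "?F \<in> borel_measurable lborel_pos"
    using assms
    by (intro borel_measurable_lborel_pos_continuous continuous_intros continuous_on_chi_square_density) auto
  fix x :: real assume x: "x > 0"
  define y where "y = sqrt (2 * \<theta> * x)"
  have y: "y > 0" "y\<^sup>2 = 2 * \<theta> * x" using assms x by (auto simp: y_def)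
  have "(\<lambda>k. exp (- \<theta>) * chi_square_density 1 x * (x / y * (y ^ (2 * k + 1) / fact (2 * k + 1)))) sums
      (exp (- \<theta>) * chi_square_density 1 x * (x / y * sinh y))"
    by (intro sums_mult sinh_odd_sums)
  moreover have "exp (- \<theta>) * chi_square_density 1 x * (x / y * (y ^ (2 * k + 1) / fact (2 * k + 1))) =
      exp (- \<theta>) * \<theta> ^ k / fact k * chi_square_density (2 * k + 3) x" for k
  proof -
    have "chi_square_density (2 * k + 3) x = x / real (2 * k + 1) * chi_square_density (2 * k + 1) x"
      using chi_square_density_add_2[of "2 * k + 1" x] x by (simp add: field_simps numeral_3_eq_3)
    moreover have "y ^ (2 * k + 1) = y * (2 * x) ^ k * \<theta> ^ k"
      using y by (simp add: power_mult power_mult_distrib)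
    ultimately show ?thesis
      unfolding chi_square_density_odd[OF x] using y(1) by (simp add: divide_simps)
  qed
  ultimately show "(\<lambda>k. exp (- \<theta>) * \<theta> ^ k / fact k * chi_square_density (2 * k + 3) x) sums ?F x"
    by (simp add: y_def)
qed (use assms in auto)

text \<open>The factor \<open>x\<close> turns \<open>chi_square_density (2 * k + 1)\<close> into
  \<open>(2 * k + 1) * chi_square_density (2 * k + 3)\<close>, so the total weight is the Poisson mean of
  \<open>2 * k + 1\<close>.\<close>

lemma has_bochner_integral_ncchi_mean:
  assumes "\<theta> > 0"
  shows "has_bochner_integral lborel_pos (\<lambda>x. x * ncchi_density \<theta> x) (1 + 2 * \<theta>)"
proof -
  let ?w = "\<lambda>k. exp (- \<theta>) * \<theta> ^ k / fact k"
  have W: "(\<lambda>k. ?w k + 2 * (real k * ?w k)) sums (1 + 2 * \<theta>)"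
    by (intro sums_add sums_mult poisson_weight_sums)
  show ?thesis
  proof (rule has_bochner_integral_chi_square_series[OF _ W, where m = "\<lambda>k. 2 * k + 3"])
    note [measurable] = borel_measurable_lborel_pos
    show "(\<lambda>x. x * ncchi_density \<theta> x) \<in> borel_measurable lborel_pos" by simp
    fix x :: real assume x: "x > 0"
    have "(\<lambda>k. x * (?w k * chi_square_density (2 * k + 1) x)) sums (x * ncchi_density \<theta> x)"
      unfolding ncchi_density_def by (intro sums_mult summable_sums summable_ncchi_density x)
    moreover have "x * (?w k * chi_square_density (2 * k + 1) x) =
        (?w k + 2 * (real k * ?w k)) * chi_square_density (2 * k + 3) x" for k
    proof -
      have "x * (?w k * chi_square_density (2 * k + 1) x) =
          ?w k * (real (2 * k + 1) * chi_square_density (2 * k + 3) x)"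
        using chi_square_density_add_2[of "2 * k + 1" x] x
        by (simp only: mult.left_commute) (simp add: numeral_3_eq_3)
      also have "\<dots> = (?w k + 2 * (real k * ?w k)) * chi_square_density (2 * k + 3) x"
        unfolding of_nat_add of_nat_mult by (simp only: of_nat_1 of_nat_numeral) algebra
      finally show ?thesis .
    qed
    ultimately show "(\<lambda>k. (?w k + 2 * (real k * ?w k)) * chi_square_density (2 * k + 3) x) sums
        (x * ncchi_density \<theta> x)" by simp
  qed (use assms in auto)
qed

section \<open>The damping integral\<close>

text \<open>The only part of the information that is not elementary. It carries the whole dependence of
  \<open>\<theta> * i(\<theta>)\<close> on \<open>\<theta>\<close> apart from an exponential factor.\<close>

definition sech_integral :: "real \<Rightarrow> real" where
  "sech_integral \<theta> = (LINT x|lborel_pos. chi_square_density 3 x / cosh (sqrt (2 * \<theta> * x)))"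

lemma has_bochner_integral_chi_square_density:
  assumes "m > 0"
  shows "has_bochner_integral lborel_pos (chi_square_density m) 1"
  using assms
  by (intro has_bochner_integral_nn_integral)
    (auto simp: chi_square_density_nonneg nn_integral_lborel_pos nn_integral_chi_square_density
      intro: borel_measurable_lborel_pos)

lemma measurable_sech_integrand:
  "(\<lambda>x. chi_square_density 3 x / cosh (sqrt (2 * \<theta> * x))) \<in> borel_measurable lborel_pos"
  by (intro borel_measurable_lborel_pos_continuous continuous_intros continuous_on_chi_square_density) auto

lemma sech_integrand_le:
  "\<bar>chi_square_density 3 x / cosh (sqrt (2 * \<theta> * x))\<bar> \<le> chi_square_density 3 x"
proof -
  have "chi_square_density 3 x * 1 \<le> chi_square_density 3 x * cosh (sqrt (2 * \<theta> * x))"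
    by (intro mult_left_mono) (auto simp: cosh_real_ge_1 chi_square_density_nonneg)
  then show ?thesis
    by (simp add: chi_square_density_nonneg divide_le_eq)
qed

lemma integrable_sech_integrand:
  "integrable lborel_pos (\<lambda>x. chi_square_density 3 x / cosh (sqrt (2 * \<theta> * x)))"
proof (rule Bochner_Integration.integrable_bound)
  show "integrable lborel_pos (chi_square_density 3)"
    using has_bochner_integral_chi_square_density[of 3] by (simp add: has_bochner_integral_iff)
qed (use measurable_sech_integrand sech_integrand_le in
      \<open>auto simp: chi_square_density_nonneg\<close>)

lemma sech_integral_le_1: "sech_integral \<theta> \<le> 1"
proof -
  have "sech_integral \<theta> \<le> (LINT x|lborel_pos. chi_square_density 3 x)"
    unfolding sech_integral_def
    using integrable_sech_integrand has_bochner_integral_chi_square_density[of 3] sech_integrand_le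
    by (intro integral_mono) (auto simp: has_bochner_integral_iff intro: order_trans[OF abs_ge_self])
  then show ?thesis
    using has_bochner_integral_chi_square_density[of 3] by (simp add: has_bochner_integral_iff)
qed

lemma sech_integral_pos: "sech_integral \<theta> > 0"
proof -
  have nn: "0 \<le> chi_square_density 3 x / cosh (sqrt (2 * \<theta> * x))" for x
    by (simp add: chi_square_density_nonneg)
  have "sech_integral \<theta> \<noteq> 0"
  proof
    assume "sech_integral \<theta> = 0"
    then have "AE x in lborel_pos. chi_square_density 3 x / cosh (sqrt (2 * \<theta> * x)) = 0"
      using integral_nonneg_eq_0_iff_AE[OF integrable_sech_integrand] nn
      by (simp add: sech_integral_def)
    then have "AE x in lborel_pos. chi_square_density 3 x = 0"
      by (simp add: less_imp_neq[OF cosh_real_pos, symmetric])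
    \<comment> \<open>contradicts the total mass 1 of the chi-squared distribution\<close>
    then have "(LINT x|lborel_pos. chi_square_density 3 x) = 0"
      by (rule integral_eq_zero_AE)
    then show False
      using has_bochner_integral_chi_square_density[of 3] by (simp add: has_bochner_integral_iff)
  qed
  moreover have "sech_integral \<theta> \<ge> 0"
    unfolding sech_integral_def using nn by (intro Bochner_Integration.integral_nonneg) auto
  ultimately show ?thesis by simp
qed

lemma sech_integral_antimono:
  assumes "0 \<le> s" "s \<le> t"
  shows "sech_integral t \<le> sech_integral s"
  unfolding sech_integral_def
proof (intro integral_mono integrable_sech_integrand)
  fix x assume "x \<in> space lborel_pos"
  then have x: "x > 0" by (simp add: space_lborel_pos)
  have "cosh (sqrt (2 * s * x)) \<le> cosh (sqrt (2 * t * x))"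
    using assms x by (subst cosh_real_nonneg_le_iff) auto
  then show "chi_square_density 3 x / cosh (sqrt (2 * t * x)) \<le>
      chi_square_density 3 x / cosh (sqrt (2 * s * x))"
    by (intro divide_left_mono) (auto simp: chi_square_density_nonneg)
qed

lemma sech_integral_tendsto_1: "(sech_integral \<longlongrightarrow> 1) (at_right 0)"
  unfolding tendsto_at_iff_sequentially
proof (intro allI impI)
  fix X :: "nat \<Rightarrow> real" assume X: "X \<longlonglongrightarrow> 0"
  have "(\<lambda>n. sech_integral (X n)) \<longlonglongrightarrow> (LINT x|lborel_pos. chi_square_density 3 x)"
    unfolding sech_integral_def
  proof (rule integral_dominated_convergence[where w = "chi_square_density 3"])
    show "AE x in lborel_pos. (\<lambda>n. chi_square_density 3 x / cosh (sqrt (2 * X n * x)))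
        \<longlonglongrightarrow> chi_square_density 3 x"
    proof (intro AE_I2)
      fix x
      have "(\<lambda>n. chi_square_density 3 x / cosh (sqrt (2 * X n * x)))
          \<longlonglongrightarrow> chi_square_density 3 x / cosh (sqrt (2 * 0 * x))"
        using X by (intro tendsto_intros) auto
      then show "(\<lambda>n. chi_square_density 3 x / cosh (sqrt (2 * X n * x))) \<longlonglongrightarrow> chi_square_density 3 x"
        by simp
    qed
  qed (use has_bochner_integral_chi_square_density[of 3] measurable_sech_integrand sech_integrand_le in
      \<open>auto simp: has_bochner_integral_iff\<close>)
  then show "(sech_integral \<circ> X) \<longlonglongrightarrow> 1"
    using has_bochner_integral_chi_square_density[of 3] by (simp add: has_bochner_integral_iff o_def)
qed

section \<open>Fisher information of the noncentral chi-squared experiment\<close>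

lemma ncchi_score:
  assumes "\<theta> > 0" "x > 0"
  shows "deriv (\<lambda>t. ln (ncchi_density t x)) \<theta> =
    x * tanh (sqrt (2 * \<theta> * x)) / sqrt (2 * \<theta> * x) - 1"
proof (rule DERIV_imp_deriv)
  have f: "chi_square_density 1 x > 0" using assms by (simp add: chi_square_density_pos)
  have "((\<lambda>t. sqrt (2 * t * x)) has_real_derivative x / sqrt (2 * \<theta> * x)) (at \<theta>)"
  proof (rule DERIV_cong)
    have "inverse S / 2 * (2 * x) = x / S" for S :: real by (simp add: field_simps)
    then show "inverse (sqrt (2 * \<theta> * x)) / 2 * (2 * x) = x / sqrt (2 * \<theta> * x)" .
    show "((\<lambda>t. sqrt (2 * t * x)) has_real_derivative inverse (sqrt (2 * \<theta> * x)) / 2 * (2 * x)) (at \<theta>)"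
      using assms
      by (intro DERIV_chain2[OF DERIV_real_sqrt]) (auto intro!: derivative_eq_intros)
  qed
  note ln_cosh = DERIV_chain2[OF DERIV_ln_divide[OF cosh_real_pos] has_field_derivative_cosh[OF this]]
  have "((\<lambda>t. - t + ln (chi_square_density 1 x) + ln (cosh (sqrt (2 * t * x)))) has_real_derivative
      x * tanh (sqrt (2 * \<theta> * x)) / sqrt (2 * \<theta> * x) - 1) (at \<theta>)"
    by (rule DERIV_cong[OF DERIV_add[OF DERIV_add[OF DERIV_minus[OF DERIV_ident] DERIV_const] ln_cosh]])
      (simp add: tanh_def)
  moreover have "\<forall>\<^sub>F t in nhds \<theta>. ln (ncchi_density t x) =
      - t + ln (chi_square_density 1 x) + ln (cosh (sqrt (2 * t * x)))"
  proof -
    have "\<forall>\<^sub>F t in nhds \<theta>. t \<in> {0<..}"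
      using assms by (intro eventually_nhds_in_open) auto
    then show ?thesis
    proof eventually_elim
      case (elim t)
      then have "ncchi_density t x = exp (- t) * chi_square_density 1 x * cosh (sqrt (2 * t * x))"
        using assms by (simp add: ncchi_density_cosh)
      then show ?case
        using f by (simp add: ln_mult)
    qed
  qed
  ultimately show "((\<lambda>t. ln (ncchi_density t x)) has_real_derivative
      x * tanh (sqrt (2 * \<theta> * x)) / sqrt (2 * \<theta> * x) - 1) (at \<theta>)"
    by (subst DERIV_cong_ev[OF refl _ refl])
qed

text \<open>Here \<open>tanh\<^sup>2 y * cosh y = cosh y - 1 / cosh y\<close> splits off the mean, and
  \<open>x * chi_square_density 1 x = chi_square_density 3 x\<close> identifies what remains.\<close>

lemma has_bochner_integral_tanh_moment:
  assumes "\<theta> > 0"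
  shows "has_bochner_integral lborel_pos (\<lambda>x. x * (tanh (sqrt (2 * \<theta> * x)))\<^sup>2 * ncchi_density \<theta> x)
    (1 + 2 * \<theta> - exp (- \<theta>) * sech_integral \<theta>)"
proof -
  have "has_bochner_integral lborel_pos
      (\<lambda>x. x * ncchi_density \<theta> x - exp (- \<theta>) * (chi_square_density 3 x / cosh (sqrt (2 * \<theta> * x))))
      (1 + 2 * \<theta> - exp (- \<theta>) * sech_integral \<theta>)"
    unfolding sech_integral_def
    by (intro has_bochner_integral_diff has_bochner_integral_mult_right
        has_bochner_integral_integrable integrable_sech_integrand
        has_bochner_integral_ncchi_mean assms)
  moreover have "x * ncchi_density \<theta> x - exp (- \<theta>) * (chi_square_density 3 x / cosh (sqrt (2 * \<theta> * x))) =
      x * (tanh (sqrt (2 * \<theta> * x)))\<^sup>2 * ncchi_density \<theta> x" if "x \<in> space lborel_pos" for x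
  proof -
    have x: "x > 0" using that by (simp add: space_lborel_pos)
    define y where "y = sqrt (2 * \<theta> * x)"
    have f3: "chi_square_density 3 x = x * chi_square_density 1 x"
      using chi_square_density_add_2[of 1 x] x by (simp add: numeral_3_eq_3)
    have "cosh y - 1 / cosh y = (sinh y)\<^sup>2 / cosh y"
      using cosh_square_eq[of y] by (simp add: divide_simps power2_eq_square)
    also have "\<dots> = (tanh y)\<^sup>2 * cosh y"
      by (simp add: tanh_def power2_eq_square)
    finally have sech: "cosh y - 1 / cosh y = (tanh y)\<^sup>2 * cosh y" .
    have g: "ncchi_density \<theta> x = exp (- \<theta>) * chi_square_density 1 x * cosh y"
      using assms x by (simp add: ncchi_density_cosh y_def)
    have "x * ncchi_density \<theta> x - exp (- \<theta>) * (chi_square_density 3 x / cosh y) =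
        x * exp (- \<theta>) * chi_square_density 1 x * (cosh y - 1 / cosh y)"
      unfolding g f3 by (simp add: right_diff_distrib)
    also have "\<dots> = x * (tanh y)\<^sup>2 * ncchi_density \<theta> x"
      unfolding sech g by simp
    finally show ?thesis unfolding y_def .
  qed
  ultimately show ?thesis
    by (subst has_bochner_integral_cong[OF refl _ refl, symmetric])
qed

text \<open>Since \<open>(x / y)\<^sup>2 = x / (2 * \<theta>)\<close>, the square of the score, multiplied by the density, is a
  combination of the three integrands whose integrals are known. They contribute \<open>1\<close>, \<open>- 2\<close> and the
  \<open>tanh\<close> moment divided by \<open>2 * \<theta>\<close>.\<close>

lemma fisher_ncchi_eq:
  assumes "\<theta> > 0"
  shows "fisher_ncchi \<theta> = ennreal ((1 - exp (- \<theta>) * sech_integral \<theta>) / (2 * \<theta>))"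
proof -
  note [measurable] = borel_measurable_lborel_pos
  define score where "score x = deriv (\<lambda>t. ln (ncchi_density t x)) \<theta>" for x
  let ?b = "\<lambda>x. exp (- \<theta>) * chi_square_density 1 x * (x * sinh (sqrt (2 * \<theta> * x)) / sqrt (2 * \<theta> * x))"
  let ?c = "\<lambda>x. x * (tanh (sqrt (2 * \<theta> * x)))\<^sup>2 * ncchi_density \<theta> x"
  have expand: "(score x)\<^sup>2 * ncchi_density \<theta> x =
      ncchi_density \<theta> x - 2 * ?b x + 1 / (2 * \<theta>) * ?c x" if x: "x > 0" for x
  proof -
    define y where "y = sqrt (2 * \<theta> * x)"
    have y: "y > 0" "x / y\<^sup>2 = 1 / (2 * \<theta>)" using assms x by (auto simp: y_def)
    have b: "exp (- \<theta>) * chi_square_density 1 x * (x * sinh y / y) = x * tanh y / y * ncchi_density \<theta> x"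
      using assms x less_imp_neq[OF cosh_real_pos[of y]]
      by (simp add: ncchi_density_cosh tanh_def y_def[symmetric])
    have "(x * tanh y / y)\<^sup>2 = 1 / (2 * \<theta>) * (x * (tanh y)\<^sup>2)"
      unfolding y(2)[symmetric] by (simp add: power2_eq_square)
    then have sq: "(x * tanh y / y - 1)\<^sup>2 = 1 - 2 * (x * tanh y / y) + 1 / (2 * \<theta>) * (x * (tanh y)\<^sup>2)"
      by (simp add: power2_diff)
    show ?thesis
      unfolding score_def ncchi_score[OF assms x] y_def[symmetric] b sq by (simp add: algebra_simps)
  qed
  have "has_bochner_integral lborel_pos
      (\<lambda>x. ncchi_density \<theta> x - 2 * ?b x + 1 / (2 * \<theta>) * ?c x)
      (1 - 2 * 1 + 1 / (2 * \<theta>) * (1 + 2 * \<theta> - exp (- \<theta>) * sech_integral \<theta>))"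
    by (intro has_bochner_integral_add has_bochner_integral_diff has_bochner_integral_mult_right
        has_bochner_integral_ncchi_density has_bochner_integral_sinh_term
        has_bochner_integral_tanh_moment assms)
  then have I: "has_bochner_integral lborel_pos (\<lambda>x. (score x)\<^sup>2 * ncchi_density \<theta> x)
      (1 - 2 * 1 + 1 / (2 * \<theta>) * (1 + 2 * \<theta> - exp (- \<theta>) * sech_integral \<theta>))"
    by (subst has_bochner_integral_cong[OF refl expand refl]) (auto simp: space_lborel_pos)
  have "fisher_ncchi \<theta> = (\<integral>\<^sup>+x. ennreal ((score x)\<^sup>2)
      \<partial>density lborel_pos (\<lambda>x. ennreal (ncchi_density \<theta> x)))"
    unfolding fisher_ncchi_def fisher_information_def noncentral_chi_square_1_density[OF assms] score_def ..
  also have "\<dots> = (\<integral>\<^sup>+x. ennreal (ncchi_density \<theta> x) * ennreal ((score x)\<^sup>2) \<partial>lborel_pos)"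
  proof (rule nn_integral_density)
    have "(\<lambda>x. x * tanh (sqrt (2 * \<theta> * x)) / sqrt (2 * \<theta> * x) - 1) \<in> borel_measurable lborel_pos"
      using assms by (intro borel_measurable_lborel_pos_continuous continuous_intros) auto
    moreover have "(score \<in> borel_measurable lborel_pos) \<longleftrightarrow>
        (\<lambda>x. x * tanh (sqrt (2 * \<theta> * x)) / sqrt (2 * \<theta> * x) - 1) \<in> borel_measurable lborel_pos"
      by (intro measurable_cong) (simp only: score_def space_lborel_pos greaterThan_iff ncchi_score[OF assms])
    ultimately have "score \<in> borel_measurable lborel_pos" by (simp only:)
    then show "(\<lambda>x. ennreal ((score x)\<^sup>2)) \<in> borel_measurable lborel_pos"
      by (intro measurable_compose[OF _ measurable_ennreal] borel_measurable_power)
  qed simp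
  also have "\<dots> = (\<integral>\<^sup>+x. ennreal ((score x)\<^sup>2 * ncchi_density \<theta> x) \<partial>lborel_pos)"
    by (simp only: ennreal_mult'' zero_le_power2 mult.commute)
  also have "\<dots> = ennreal (LINT x|lborel_pos. (score x)\<^sup>2 * ncchi_density \<theta> x)"
    using I assms by (intro nn_integral_eq_integral)
      (auto simp: has_bochner_integral_iff space_lborel_pos intro!: AE_I2 mult_nonneg_nonneg ncchi_density_nonneg)
  also have "(LINT x|lborel_pos. (score x)\<^sup>2 * ncchi_density \<theta> x) =
      1 - 2 * 1 + 1 / (2 * \<theta>) * (1 + 2 * \<theta> - exp (- \<theta>) * sech_integral \<theta>)"
    using I by (simp add: has_bochner_integral_iff)
  also have "\<dots> = (1 - exp (- \<theta>) * sech_integral \<theta>) / (2 * \<theta>)"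
    using assms by (simp add: field_simps)
  finally show ?thesis .
qed

theorem proposition12:
  fixes r :: "real \<Rightarrow> real"
  assumes r: "\<And>\<theta>. 0 < \<theta> \<Longrightarrow> r \<theta> = \<theta> * enn2real (fisher_ncchi \<theta>)"
  shows "(\<forall>\<theta>>0. fisher_ncchi \<theta> < \<infinity> \<and>
            enn2real (fisher_ncchi \<theta>) =
              1 / (2 * \<theta>) *
                (LINT x:{0<..}|lborel. x * (tanh (sqrt (2 * \<theta> * x)))\<^sup>2 * ncchi_density \<theta> x) - 1)
       \<and> (r \<longlongrightarrow> 0) (at_right 0)
       \<and> (r \<longlongrightarrow> 1 / 2) at_top
       \<and> strict_mono_on {0<..} r
       \<and> (\<forall>\<theta>>0. fisher_ncchi \<theta> \<le> ennreal (1 / 2) * fisher_poisson \<theta>)"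
proof -
  define K where "K = sech_integral"
  have K: "0 < K \<theta>" "K \<theta> \<le> 1" for \<theta>
    by (simp_all add: K_def sech_integral_pos sech_integral_le_1)
  have eK: "0 < exp (- \<theta>) * K \<theta>" "exp (- \<theta>) * K \<theta> \<le> 1" if "\<theta> > 0" for \<theta>
    using mult_mono[of "exp (- \<theta>)" 1 "K \<theta>" 1] K[of \<theta>] that by auto
  have i: "enn2real (fisher_ncchi \<theta>) = (1 - exp (- \<theta>) * K \<theta>) / (2 * \<theta>)" if "\<theta> > 0" for \<theta>
    using eK[OF that] that by (simp add: fisher_ncchi_eq K_def)
  have r_eq: "r \<theta> = (1 - exp (- \<theta>) * K \<theta>) / 2" if "\<theta> > 0" for \<theta>
    using that by (simp add: r i)
  have formula: "enn2real (fisher_ncchi \<theta>) = 1 / (2 * \<theta>) *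
      (LINT x:{0<..}|lborel. x * (tanh (sqrt (2 * \<theta> * x)))\<^sup>2 * ncchi_density \<theta> x) - 1"
    if "\<theta> > 0" for \<theta>
  proof -
    have "(LINT x:{0<..}|lborel. x * (tanh (sqrt (2 * \<theta> * x)))\<^sup>2 * ncchi_density \<theta> x) =
        (LINT x|lborel_pos. x * (tanh (sqrt (2 * \<theta> * x)))\<^sup>2 * ncchi_density \<theta> x)"
      unfolding lborel_pos_def set_lebesgue_integral_def by (subst integral_restrict_space) auto
    also have "\<dots> = 1 + 2 * \<theta> - exp (- \<theta>) * K \<theta>"
      using has_bochner_integral_tanh_moment[OF that] by (simp add: has_bochner_integral_iff K_def)
    finally show ?thesis
      using that by (simp add: i field_simps)
  qed
  have at_0: "(r \<longlongrightarrow> 0) (at_right 0)"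
  proof -
    have "((\<lambda>\<theta>. (1 - exp (- \<theta>) * K \<theta>) / 2) \<longlongrightarrow> (1 - exp (- 0) * 1) / 2) (at_right 0)"
      unfolding K_def by (intro tendsto_intros sech_integral_tendsto_1) auto
    moreover have "\<forall>\<^sub>F \<theta> in at_right 0. (1 - exp (- \<theta>) * K \<theta>) / 2 = r \<theta>"
      by (auto simp: eventually_at_filter r_eq)
    ultimately show ?thesis by (simp add: tendsto_cong)
  qed
  have at_infinity: "(r \<longlongrightarrow> 1 / 2) at_top"
  proof -
    have "((\<lambda>\<theta>. exp (- \<theta>) * K \<theta>) \<longlongrightarrow> 0) at_top"
    proof (rule tendsto_sandwich[where f = "\<lambda>_. 0" and h = "\<lambda>\<theta>. exp (- \<theta>)"])
      show "((\<lambda>\<theta>::real. exp (- \<theta>)) \<longlongrightarrow> 0) at_top"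
        by (intro filterlim_compose[OF exp_at_bot] filterlim_uminus_at_bot_at_top)
      show "\<forall>\<^sub>F \<theta> in at_top. 0 \<le> exp (- \<theta>) * K \<theta>" "\<forall>\<^sub>F \<theta> in at_top. exp (- \<theta>) * K \<theta> \<le> exp (- \<theta>)"
        using K by (auto intro!: always_eventually less_imp_le)
    qed simp
    then have "((\<lambda>\<theta>. (1 - exp (- \<theta>) * K \<theta>) / 2) \<longlongrightarrow> (1 - 0) / 2) at_top"
      by (intro tendsto_intros) auto
    moreover have "\<forall>\<^sub>F \<theta> in at_top. (1 - exp (- \<theta>) * K \<theta>) / 2 = r \<theta>"
      using eventually_gt_at_top[of 0] by eventually_elim (simp add: r_eq)
    ultimately show ?thesis by (simp add: tendsto_cong)
  qed
  have mono: "strict_mono_on {0<..} r"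
  proof (rule strict_mono_onI)
    fix s t :: real assume st: "s \<in> {0<..}" "t \<in> {0<..}" "s < t"
    have "exp (- t) * K t \<le> exp (- t) * K s"
      using st by (simp add: K_def sech_integral_antimono)
    also have "\<dots> < exp (- s) * K s"
      using st K[of s] by simp
    finally show "r s < r t"
      using st by (simp add: r_eq)
  qed
  have "fisher_ncchi \<theta> \<le> ennreal (1 / 2) * fisher_poisson \<theta>" if "\<theta> > 0" for \<theta>
  proof -
    have "(1 - exp (- \<theta>) * K \<theta>) / (2 * \<theta>) \<le> 1 / 2 * (1 / \<theta>)"
      using eK[OF that] that by (simp add: divide_simps)
    then have "fisher_ncchi \<theta> \<le> ennreal (1 / 2 * (1 / \<theta>))"
      unfolding fisher_ncchi_eq[OF that] K_def by (rule ennreal_leI)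
    also have "\<dots> = ennreal (1 / 2) * fisher_poisson \<theta>"
      unfolding fisher_poisson_eq[OF that] by (rule ennreal_mult') simp
    finally show ?thesis .
  qed
  moreover have "fisher_ncchi \<theta> < \<infinity>" if "\<theta> > 0" for \<theta>
    using that by (simp add: fisher_ncchi_eq)
  ultimately show ?thesis
    using formula at_0 at_infinity mono by blast
qed

end
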